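(* Consider the system $$\begin{aligned} \frac{dx}{dt} &=\frac{2x^2y}{t}+x^2-\frac{2xy}{t}-\left(1+\frac{2\alpha_2+2\alpha_3+\alpha_5+\alpha_4}{t}\right)x+\frac{\alpha_2+\alpha_5}{t}+\frac{2z((z-1)w+\alpha_3)}{t},\\ \frac{dy}{dt} &=-\frac{2xy^2}{t}+\frac{y^2}{t}-2xy+\left(1+\frac{2\alpha_2+2\alpha_3+\alpha_5+\alpha_4}{t}\right)y-\alpha_1,\\ \frac{dz}{dt} &=\frac{2z^2w}{t}+z^2-\frac{2zw}{t}-\left(1+\frac{\alpha_5+\alpha_4}{t}\right)z+\frac{\alpha_5}{t}+\frac{2yz(z-1)}{t},\\ \frac{dw}{dt} &=-\frac{2zw^2}{t}+\frac{w^2}{t}-2zw+\left(1+\frac{\alpha_5+\alpha_4}{t}\right)w-\alpha_3-\frac{2y(-w+2zw+\alpha_3)}{t} \end{aligned}$$ with complex parameters satisfying $\alpha_0+\alpha_1+2\alpha_2+2\alpha_3+\alpha_4+\alpha_5=1$. Make the change of parameters and variables $$\alpha_0=A_0-A_2-A_3+\tfrac12\varepsilon^{-2},\ \alpha_1=A_1,\ \alpha_2=A_2,\ \alpha_3=A_3,\ \alpha_4=-\tfrac12\varepsilon^{-2},\ \alpha_5=A_4,$$ $$t=\tfrac12\varepsilon^{-2}(1+2\varepsilon T),\quad x=-\frac{\varepsilon X}{1-\varepsilon X},\quad y=-\varepsilon^{-1}(1-\varepsilon X)[Y-\varepsilon(A_1+XY)],$$ $$z=-\frac{\varepsilon Z}{1-\varepsilon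 Z},\quad w=-\varepsilon^{-1}(1-\varepsilon Z)[W-\varepsilon(A_3+ZW)]$$ from $\alpha_0,\dots,\alpha_5,t,x,y,z,w$ to $A_0,\dots,A_4,\varepsilon,T,X,Y,Z,W$. Then the system can also be written in the new variables $T,X,Y,Z,W$ and parameters $A_0,\dots,A_4,\varepsilon$ as a Hamiltonian system, and this new system tends, as $\varepsilon\to0$, to the system of type $A_4^{(1)}$, namely $$\begin{aligned} \frac{dX}{dT} &=-X^2+4XY+4ZW-2TX-2A_2-2A_4,\\ \frac{dY}{dT} &=-2Y^2+2XY+2TY+A_1,\\ \frac{dZ}{dT} &=-Z^2+4ZW+4YZ-2TZ-2A_4,\\ \frac{dW}{dT} &=-2W^2+2ZW-4YW+2TW+A_3, \end{aligned}\qquad A_0+A_1+A_2+A_3+A_4=1.$$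
   Context: A Hamiltonian system in $(X,Y,Z,W)$ with independent variable $T$ is one of the form $dX/dT=\partial K/\partial Y$, $dY/dT=-\partial K/\partial X$, $dZ/dT=\partial K/\partial W$, $dW/dT=-\partial K/\partial Z$. "Tends to" means that the right-hand sides of the transformed system converge to those of the limiting system as $\varepsilon\to0$ with $T,X,Y,Z,W,A_0,\dots,A_4$ fixed. *)

theory Defs
  imports "HOL-Complex_Analysis.Complex_Analysis"
begin

text \<open>A (non-autonomous) vector field on a four-dimensional complex phase space; the first
  argument is the independent variable.\<close>

type_synonym field4 =
  "complex \<Rightarrow> complex \<Rightarrow> complex \<Rightarrow> complex \<Rightarrow> complex \<Rightarrow> complex \<times> complex \<times> complex \<times> complex"

definition solves ::
  "field4 \<Rightarrow> complex set \<Rightarrow> (complex \<Rightarrow> complex) \<Rightarrow> (complex \<Rightarrow> complex)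
    \<Rightarrow> (complex \<Rightarrow> complex) \<Rightarrow> (complex \<Rightarrow> complex) \<Rightarrow> bool"
  where "solves F U x y z w \<longleftrightarrow>
    (\<forall>t\<in>U. case F t (x t) (y t) (z t) (w t) of (fx, fy, fz, fw) \<Rightarrow>
       (x has_field_derivative fx) (at t) \<and> (y has_field_derivative fy) (at t) \<and>
       (z has_field_derivative fz) (at t) \<and> (w has_field_derivative fw) (at t))"

text \<open>The parameter \<open>\<alpha>\<^sub>0\<close> enters only through the normalisation
  \<open>\<alpha>\<^sub>0 + \<alpha>\<^sub>1 + 2\<alpha>\<^sub>2 + 2\<alpha>\<^sub>3 + \<alpha>\<^sub>4 + \<alpha>\<^sub>5 = 1\<close>.\<close>

definition source_field ::
  "complex \<Rightarrow> complex \<Rightarrow> complex \<Rightarrow> complex \<Rightarrow> complex \<Rightarrow> field4"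
  where "source_field \<alpha>1 \<alpha>2 \<alpha>3 \<alpha>4 \<alpha>5 t x y z w =
   (2 * x^2 * y / t + x^2 - 2 * x * y / t
      - (1 + (2 * \<alpha>2 + 2 * \<alpha>3 + \<alpha>5 + \<alpha>4) / t) * x
      + (\<alpha>2 + \<alpha>5) / t + 2 * z * ((z - 1) * w + \<alpha>3) / t,
    - (2 * x * y^2 / t) + y^2 / t - 2 * x * y
      + (1 + (2 * \<alpha>2 + 2 * \<alpha>3 + \<alpha>5 + \<alpha>4) / t) * y - \<alpha>1,
    2 * z^2 * w / t + z^2 - 2 * z * w / t
      - (1 + (\<alpha>5 + \<alpha>4) / t) * z
      + \<alpha>5 / t + 2 * y * z * (z - 1) / t,
    - (2 * z * w^2 / t) + w^2 / t - 2 * z * w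
      + (1 + (\<alpha>5 + \<alpha>4) / t) * w - \<alpha>3 - 2 * y * (- w + 2 * z * w + \<alpha>3) / t)"

text \<open>The system of type \<open>A\<^sub>4\<^sup>(\<^sup>1\<^sup>)\<close>; the parameter \<open>A\<^sub>0\<close> enters only through the
  normalisation \<open>A\<^sub>0 + A\<^sub>1 + A\<^sub>2 + A\<^sub>3 + A\<^sub>4 = 1\<close>.\<close>

definition A4_field ::
  "complex \<Rightarrow> complex \<Rightarrow> complex \<Rightarrow> complex \<Rightarrow> field4"
  where "A4_field A1 A2 A3 A4 T X Y Z W =
   (- (X^2) + 4 * X * Y + 4 * Z * W - 2 * T * X - 2 * A2 - 2 * A4,
    - (2 * Y^2) + 2 * X * Y + 2 * T * Y + A1,
    - (Z^2) + 4 * Z * W + 4 * Y * Z - 2 * T * Z - 2 * A4,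
    - (2 * W^2) + 2 * Z * W - 4 * Y * W + 2 * T * W + A3)"

text \<open>The Hamiltonian is a function of the independent variable and of the phase variables, and
  the canonical pairs are \<open>(X, Y)\<close> and \<open>(Z, W)\<close>. The function \<open>deriv\<close> is total, so
  \<open>hamiltonian_field\<close> is meaningful only at points where the partial derivatives exist,
  which is what \<open>hamiltonian_on\<close> provides.\<close>

definition hamiltonian_field ::
  "(complex \<Rightarrow> complex \<Rightarrow> complex \<Rightarrow> complex \<Rightarrow> complex \<Rightarrow> complex) \<Rightarrow> field4"
  where "hamiltonian_field K T X Y Z W =
   (deriv (\<lambda>Y'. K T X Y' Z W) Y,
    - deriv (\<lambda>X'. K T X' Y Z W) X,
    deriv (\<lambda>W'. K T X Y Z W') W,
    - deriv (\<lambda>Z'. K T X Y Z' W) Z)"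

text \<open>On an open set, complex differentiability in each variable separately is the same as joint
  holomorphy (Hartogs).\<close>

definition hamiltonian_on ::
  "(complex \<times> complex \<times> complex \<times> complex \<times> complex) set
    \<Rightarrow> (complex \<Rightarrow> complex \<Rightarrow> complex \<Rightarrow> complex \<Rightarrow> complex \<Rightarrow> complex) \<Rightarrow> bool"
  where "hamiltonian_on D K \<longleftrightarrow>
    (\<forall>(T, X, Y, Z, W)\<in>D.
       (\<lambda>T'. K T' X Y Z W) field_differentiable (at T) \<and>
       (\<lambda>X'. K T X' Y Z W) field_differentiable (at X) \<and>
       (\<lambda>Y'. K T X Y' Z W) field_differentiable (at Y) \<and>
       (\<lambda>Z'. K T X Y Z' W) field_differentiable (at Z) \<and>
       (\<lambda>W'. K T X Y Z W') field_differentiable (at W))"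

definition parameter_change ::
  "complex \<Rightarrow> complex \<Rightarrow> complex \<Rightarrow> complex \<Rightarrow> complex \<Rightarrow> complex
    \<Rightarrow> complex \<Rightarrow> complex \<Rightarrow> complex \<Rightarrow> complex \<Rightarrow> complex \<Rightarrow> complex \<Rightarrow> bool"
  where "parameter_change \<alpha>0 \<alpha>1 \<alpha>2 \<alpha>3 \<alpha>4 \<alpha>5 A0 A1 A2 A3 A4 \<epsilon> \<longleftrightarrow>
    \<alpha>0 = A0 - A2 - A3 + inverse (\<epsilon>^2) / 2 \<and> \<alpha>1 = A1 \<and> \<alpha>2 = A2 \<and> \<alpha>3 = A3 \<and>
    \<alpha>4 = - (inverse (\<epsilon>^2) / 2) \<and> \<alpha>5 = A4"

definition old_time :: "complex \<Rightarrow> complex \<Rightarrow> complex"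
  where "old_time \<epsilon> T = inverse (\<epsilon>^2) / 2 * (1 + 2 * \<epsilon> * T)"

text \<open>The same formulas serve for \<open>(x, y)\<close>, with \<open>a = A\<^sub>1\<close>, \<open>Q = X\<close>, \<open>P = Y\<close>, and for
  \<open>(z, w)\<close>, with \<open>a = A\<^sub>3\<close>, \<open>Q = Z\<close>, \<open>P = W\<close>.\<close>

definition old_position :: "complex \<Rightarrow> complex \<Rightarrow> complex"
  where "old_position \<epsilon> Q = - (\<epsilon> * Q / (1 - \<epsilon> * Q))"

definition old_momentum :: "complex \<Rightarrow> complex \<Rightarrow> complex \<Rightarrow> complex \<Rightarrow> complex"
  where "old_momentum \<epsilon> a Q P = - (inverse \<epsilon> * (1 - \<epsilon> * Q) * (P - \<epsilon> * (a + Q * P)))"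

text \<open>The points \<open>(T, X, Y, Z, W)\<close> at which the change of variables is defined and the old time
  avoids the singularity \<open>t = 0\<close>.\<close>

definition new_domain ::
  "complex \<Rightarrow> (complex \<times> complex \<times> complex \<times> complex \<times> complex) set"
  where "new_domain \<epsilon> =
    {(T, X, Y, Z, W). 1 + 2 * \<epsilon> * T \<noteq> 0 \<and> 1 - \<epsilon> * X \<noteq> 0 \<and> 1 - \<epsilon> * Z \<noteq> 0}"

definition variable_change ::
  "complex \<Rightarrow> complex \<Rightarrow> complex \<Rightarrow> complex set
    \<Rightarrow> (complex \<Rightarrow> complex) \<Rightarrow> (complex \<Rightarrow> complex) \<Rightarrow> (complex \<Rightarrow> complex) \<Rightarrow> (complex \<Rightarrow> complex)
    \<Rightarrow> (complex \<Rightarrow> complex) \<Rightarrow> (complex \<Rightarrow> complex) \<Rightarrow> (complex \<Rightarrow> complex) \<Rightarrow> (complex \<Rightarrow> complex)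
    \<Rightarrow> bool"
  where "variable_change \<epsilon> A1 A3 U x y z w X Y Z W \<longleftrightarrow>
    (\<forall>T\<in>U. (T, X T, Y T, Z T, W T) \<in> new_domain \<epsilon> \<and>
       x (old_time \<epsilon> T) = old_position \<epsilon> (X T) \<and>
       y (old_time \<epsilon> T) = old_momentum \<epsilon> A1 (X T) (Y T) \<and>
       z (old_time \<epsilon> T) = old_position \<epsilon> (Z T) \<and>
       w (old_time \<epsilon> T) = old_momentum \<epsilon> A3 (Z T) (W T))"

end

theory Submission
  imports Defs
begin

text \<open>The source system is Hamiltonian, with the Hamiltonian \<open>H\<close> called \<open>source_hamiltonian\<close> below.
  At fixed time the change of variables is canonical: each pair changes by a point transformation
  \<open>x = x(X)\<close> followed by a momentum of the form \<open>y = b(X) + c(X) Y\<close>, and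
  \<open>\<partial>x/\<partial>X \<cdot> \<partial>y/\<partial>Y = (- \<epsilon> / (1 - \<epsilon> X)\<^sup>2) \<cdot> (- (1 - \<epsilon> X)\<^sup>2 / \<epsilon>) = 1\<close>. The formulas for \<open>x, y, z, w\<close>
  do not involve \<open>T\<close>, so no correction term arises, and \<open>dt = dT / \<epsilon>\<close> shows that the new equations
  are those of \<open>K = H / \<epsilon>\<close>, with \<open>H\<close> taken at the old variables.

  Two things remain. As it stands, \<open>H / \<epsilon>\<close> contains terms of order \<open>\<epsilon>\<^sup>-\<^sup>1\<close>: those with the large
  parameter \<open>\<alpha>\<^sub>4 = - \<epsilon>\<^sup>-\<^sup>2 / 2\<close> and those, \<open>- (XY + ZW) / \<epsilon>\<close>, from the part of \<open>H\<close> that is not divided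
  by \<open>t\<close>. They cancel, and \<open>K\<close> becomes a polynomial in \<open>X, Y, Z, W, T, \<epsilon>\<close> divided by
  \<open>1 + 2 \<epsilon> T\<close> (\<open>new_hamiltonian_eq_pullback\<close>). Hence the vector field of \<open>K\<close> is continuous at
  \<open>\<epsilon> = 0\<close>, where it is the \<open>A\<^sub>4\<close> field (\<open>new_hamiltonian_field_tendsto\<close>).

  The equivalence of the two systems holds for differentiation at a single time. It follows from the
  chain rule for \<open>H\<close> (\<open>new_hamiltonian_field_eq\<close>) and from the fact that the change of
  variables is invertible with a holomorphic inverse (\<open>derivatives_canonical_pair_iff\<close>).\<close>

section \<open>The Hamiltonian of the source system\<close>

definition source_hamiltonian ::
  "complex \<Rightarrow> complex \<Rightarrow> complex \<Rightarrow> complex \<Rightarrow> complex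
    \<Rightarrow> complex \<Rightarrow> complex \<Rightarrow> complex \<Rightarrow> complex \<Rightarrow> complex \<Rightarrow> complex"
  where "source_hamiltonian \<alpha>1 \<alpha>2 \<alpha>3 \<alpha>4 \<alpha>5 t x y z w =
    (x * (x - 1) * y * (y + t) - (2 * \<alpha>2 + 2 * \<alpha>3 + \<alpha>5 + \<alpha>4) * x * y + (\<alpha>2 + \<alpha>5) * y) / t + \<alpha>1 * x
    + (z * (z - 1) * w * (w + t) - (\<alpha>5 + \<alpha>4) * z * w + \<alpha>5 * w) / t + \<alpha>3 * z
    + 2 * y * z * ((z - 1) * w + \<alpha>3) / t"

text \<open>The differential of \<open>H\<close> at fixed \<open>t\<close>. The source field enters as the symplectic gradient of
  \<open>H\<close>: \<open>f\<^sub>x = \<partial>H/\<partial>y\<close>, \<open>f\<^sub>y = - \<partial>H/\<partial>x\<close>, and likewise for \<open>(z, w)\<close>. Stating it along an arbitrary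
  curve gives each partial derivative of the pulled back \<open>H\<close> by choosing a coordinate line.\<close>

lemma source_hamiltonian_along_curve:
  assumes "t \<noteq> 0"
    and "source_field \<alpha>1 \<alpha>2 \<alpha>3 \<alpha>4 \<alpha>5 t (x s) (y s) (z s) (w s) = (fx, fy, fz, fw)"
    and "(x has_field_derivative x') (at s)" "(y has_field_derivative y') (at s)"
    and "(z has_field_derivative z') (at s)" "(w has_field_derivative w') (at s)"
  shows "((\<lambda>s. source_hamiltonian \<alpha>1 \<alpha>2 \<alpha>3 \<alpha>4 \<alpha>5 t (x s) (y s) (z s) (w s))
           has_field_derivative fx * y' - fy * x' + fz * w' - fw * z') (at s)"
proof -
  note [derivative_intros] = assms(3-6)
  from assms(2) have F:
    "fx = 2 * (x s)^2 * y s / t + (x s)^2 - 2 * x s * y s / t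
      - (1 + (2 * \<alpha>2 + 2 * \<alpha>3 + \<alpha>5 + \<alpha>4) / t) * x s
      + (\<alpha>2 + \<alpha>5) / t + 2 * z s * ((z s - 1) * w s + \<alpha>3) / t"
    "fy = - (2 * x s * (y s)^2 / t) + (y s)^2 / t - 2 * x s * y s
      + (1 + (2 * \<alpha>2 + 2 * \<alpha>3 + \<alpha>5 + \<alpha>4) / t) * y s - \<alpha>1"
    "fz = 2 * (z s)^2 * w s / t + (z s)^2 - 2 * z s * w s / t
      - (1 + (\<alpha>5 + \<alpha>4) / t) * z s
      + \<alpha>5 / t + 2 * y s * z s * (z s - 1) / t"
    "fw = - (2 * z s * (w s)^2 / t) + (w s)^2 / t - 2 * z s * w s
      + (1 + (\<alpha>5 + \<alpha>4) / t) * w s - \<alpha>3 - 2 * y s * (- w s + 2 * z s * w s + \<alpha>3) / t"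
    by (auto simp: source_field_def)
  show ?thesis
    unfolding source_hamiltonian_def
    apply (rule derivative_eq_intros refl \<open>t \<noteq> 0\<close>)+
    unfolding F using \<open>t \<noteq> 0\<close>
    by (simp add: divide_simps) (simp add: algebra_simps power2_eq_square)
qed

section \<open>The Hamiltonian in the new variables\<close>

text \<open>This is \<open>H / \<epsilon>\<close> in the new variables after the poles at \<open>\<epsilon> = 0\<close> have cancelled. The
  abbreviations \<open>p\<close> and \<open>q\<close> are the brackets in the formulas for \<open>y\<close> and \<open>w\<close>, that is
  \<open>y = - (1 - \<epsilon> X) p / \<epsilon>\<close> and \<open>w = - (1 - \<epsilon> Z) q / \<epsilon>\<close>.\<close>

definition new_hamiltonian ::
  "complex \<Rightarrow> complex \<Rightarrow> complex \<Rightarrow> complex \<Rightarrow> complex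
    \<Rightarrow> complex \<Rightarrow> complex \<Rightarrow> complex \<Rightarrow> complex \<Rightarrow> complex \<Rightarrow> complex"
  where "new_hamiltonian A1 A2 A3 A4 \<epsilon> T X Y Z W =
    (let p = Y * (1 - \<epsilon> * X) - \<epsilon> * A1; q = W * (1 - \<epsilon> * Z) - \<epsilon> * A3 in
     (2 * X * p^2 - 2 * \<epsilon> * (2 * A2 + 2 * A3 + A4) * X * p - 2 * (A2 + A4) * (1 - \<epsilon> * X) * p
        - X * (X * Y + A1 + 2 * T * Y)
      + 2 * Z * q^2 - 2 * \<epsilon> * A4 * Z * q - 2 * A4 * (1 - \<epsilon> * Z) * q
        - Z * (Z * W + A3 + 2 * T * W)
      + 4 * (1 - \<epsilon> * X) * p * Z * W) / (1 + 2 * \<epsilon> * T))"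

lemma old_momentum_eq:
  "\<epsilon> \<noteq> 0 \<Longrightarrow> old_momentum \<epsilon> a Q P = - ((1 - \<epsilon> * Q) * (P * (1 - \<epsilon> * Q) - \<epsilon> * a) / \<epsilon>)"
  by (simp add: old_momentum_def field_simps)

text \<open>The monomials of \<open>H\<close>, grouped so that the denominators \<open>1 - \<epsilon> Q\<close> drop out. They do because
  \<open>1 - \<epsilon> Q = 1 / (1 - x)\<close>. The momentum is shifted by \<open>\<epsilon> a\<close> so that \<open>(x - 1) y + a\<close> is a multiple
  of \<open>(1 - \<epsilon> Q) P\<close>.\<close>

lemma position_momentum_products:
  fixes \<epsilon> a Q P :: complex
  defines "x \<equiv> old_position \<epsilon> Q" and "y \<equiv> old_momentum \<epsilon> a Q P" and "p \<equiv> P * (1 - \<epsilon> * Q) - \<epsilon> * a"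
  assumes "\<epsilon> \<noteq> 0" "1 - \<epsilon> * Q \<noteq> 0"
  shows "x * (x - 1) * y + a * x = - (Q * P)"
    and "x * (x - 1) * y^2 = Q * p^2 / \<epsilon>"
    and "x * y = Q * p"
    and "y = - ((1 - \<epsilon> * Q) * p / \<epsilon>)"
    and "x * ((x - 1) * y + a) = - (Q * P)"
proof -
  define r where "r = 1 - \<epsilon> * Q"
  have r: "r \<noteq> 0" using assms r_def by simp
  have x: "x = - (\<epsilon> * Q / r)" by (simp add: x_def old_position_def r_def)
  have x1: "x - 1 = - (1 / r)" using r unfolding x by (simp add: r_def field_simps)
  show y: "y = - ((1 - \<epsilon> * Q) * p / \<epsilon>)"
    using assms(4) by (simp add: y_def p_def old_momentum_eq)
  have y': "y = - (r * p / \<epsilon>)" by (simp add: y r_def)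
  have p: "p = P * r - \<epsilon> * a" by (simp add: p_def r_def)
  show xy: "x * y = Q * p" using r assms(4) by (simp add: x y')
  have x1y: "(x - 1) * y + a = P * r / \<epsilon>"
    using r assms(4) by (simp add: x1 y' p field_simps)
  show *: "x * ((x - 1) * y + a) = - (Q * P)"
    unfolding x1y unfolding x using r assms(4) by simp
  then show "x * (x - 1) * y + a * x = - (Q * P)" by (simp add: algebra_simps)
  show "x * (x - 1) * y^2 = Q * p^2 / \<epsilon>"
    unfolding x1 unfolding x y' using r assms(4) by (simp add: power2_eq_square)
qed

text \<open>After grouping, the only terms of \<open>H / \<epsilon>\<close> that are singular at \<open>\<epsilon> = 0\<close> are
  \<open>X (p - s Y) / (\<epsilon> s)\<close> and \<open>Z (q - s W) / (\<epsilon> s)\<close> with \<open>s = 1 + 2 \<epsilon> T\<close>. Both \<open>p\<close> and \<open>s Y\<close> equal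
  \<open>Y\<close> up to order \<open>\<epsilon>\<close>, so the quotients are regular. The term with \<open>p\<close> comes from
  \<open>\<alpha>\<^sub>4\<close>, and the one with \<open>s Y\<close> from the part of \<open>H\<close> that is not divided by \<open>t\<close>.\<close>

lemma new_hamiltonian_eq_pullback:
  assumes \<epsilon>: "\<epsilon> \<noteq> 0" and D: "(T, X, Y, Z, W) \<in> new_domain \<epsilon>"
  shows "new_hamiltonian A1 A2 A3 A4 \<epsilon> T X Y Z W =
    source_hamiltonian A1 A2 A3 (- (inverse (\<epsilon>^2) / 2)) A4 (old_time \<epsilon> T)
      (old_position \<epsilon> X) (old_momentum \<epsilon> A1 X Y) (old_position \<epsilon> Z) (old_momentum \<epsilon> A3 Z W) / \<epsilon>"
proof -
  define x y z w where xyzw: "x = old_position \<epsilon> X" "y = old_momentum \<epsilon> A1 X Y"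
    "z = old_position \<epsilon> Z" "w = old_momentum \<epsilon> A3 Z W"
  define p q where pq: "p = Y * (1 - \<epsilon> * X) - \<epsilon> * A1" "q = W * (1 - \<epsilon> * Z) - \<epsilon> * A3"
  define s where "s = 1 + 2 * \<epsilon> * T"
  define t where "t = old_time \<epsilon> T"
  \<comment> \<open>The coefficients of \<open>- x y / t\<close> and \<open>- z w / t\<close> in \<open>H\<close>; both contain the large \<open>\<alpha>\<^sub>4\<close>.\<close>
  define \<beta> \<gamma> where \<beta>\<gamma>: "\<beta> = 2 * A2 + 2 * A3 + A4 - inverse (\<epsilon>^2) / 2" "\<gamma> = A4 - inverse (\<epsilon>^2) / 2"
  have nz: "1 - \<epsilon> * X \<noteq> 0" "1 - \<epsilon> * Z \<noteq> 0" "s \<noteq> 0"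
    using D by (auto simp: new_domain_def s_def)
  have t: "t = s / (2 * \<epsilon>^2)" by (simp add: t_def old_time_def s_def field_simps)
  have t0: "t \<noteq> 0" using t nz \<epsilon> by simp
  note P = position_momentum_products[OF \<epsilon> nz(1), of A1 Y, folded xyzw pq]
  note Q = position_momentum_products[OF \<epsilon> nz(2), of A3 W, folded xyzw pq]
  have "source_hamiltonian A1 A2 A3 (- (inverse (\<epsilon>^2) / 2)) A4 t x y z w =
      (x * (x - 1) * y^2 - \<beta> * (x * y) + (A2 + A4) * y
       + z * (z - 1) * w^2 - \<gamma> * (z * w) + A4 * w + 2 * y * (z * ((z - 1) * w + A3))) / t
      + (x * (x - 1) * y + A1 * x) + (z * (z - 1) * w + A3 * z)"
    using t0 by (simp add: source_hamiltonian_def \<beta>\<gamma> field_simps power2_eq_square)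
  also have "\<dots> = (X * p^2 / \<epsilon> - \<beta> * (X * p) - (A2 + A4) * ((1 - \<epsilon> * X) * p / \<epsilon>)
       + Z * q^2 / \<epsilon> - \<gamma> * (Z * q) - A4 * ((1 - \<epsilon> * Z) * q / \<epsilon>)
       + 2 * ((1 - \<epsilon> * X) * p / \<epsilon>) * (Z * W)) / t - X * Y - Z * W"
    unfolding P(1-3,5) Q(1-3,5) unfolding P(4) Q(4) by simp
  also have "\<dots> / \<epsilon> = (2 * X * p^2 - 2 * \<epsilon> * \<beta> * X * p - 2 * (A2 + A4) * (1 - \<epsilon> * X) * p
       + 2 * Z * q^2 - 2 * \<epsilon> * \<gamma> * Z * q - 2 * A4 * (1 - \<epsilon> * Z) * q
       + 4 * (1 - \<epsilon> * X) * p * Z * W) / s - (X * Y + Z * W) / \<epsilon>"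
    using nz(3) \<epsilon> by (simp add: t divide_simps) (simp add: algebra_simps power2_eq_square)
  also have "\<dots> = (2 * X * p^2 - 2 * \<epsilon> * (2 * A2 + 2 * A3 + A4) * X * p - 2 * (A2 + A4) * (1 - \<epsilon> * X) * p
       + 2 * Z * q^2 - 2 * \<epsilon> * A4 * Z * q - 2 * A4 * (1 - \<epsilon> * Z) * q
       + 4 * (1 - \<epsilon> * X) * p * Z * W + X * ((p - s * Y) / \<epsilon>) + Z * ((q - s * W) / \<epsilon>)) / s"
    using nz(3) \<epsilon> by (simp add: \<beta>\<gamma> divide_simps) (simp add: algebra_simps power2_eq_square)
  also have "(p - s * Y) / \<epsilon> = - (X * Y + A1 + 2 * T * Y)"
    using \<epsilon> by (simp add: pq s_def field_simps)
  also have "(q - s * W) / \<epsilon> = - (Z * W + A3 + 2 * T * W)"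
    using \<epsilon> by (simp add: pq s_def field_simps)
  finally show ?thesis
    by (simp add: new_hamiltonian_def Let_def xyzw pq t_def s_def algebra_simps)
qed

lemma old_position_has_derivative:
  assumes "1 - \<epsilon> * Q s \<noteq> 0" "(Q has_field_derivative u) (at s)"
  shows "((\<lambda>s. old_position \<epsilon> (Q s)) has_field_derivative - (\<epsilon> / (1 - \<epsilon> * Q s)^2) * u) (at s)"
  unfolding old_position_def
  apply (rule derivative_eq_intros assms refl)+
  using assms(1) by (simp add: divide_simps) (simp add: algebra_simps power2_eq_square)

lemma old_momentum_has_derivative:
  assumes "\<epsilon> \<noteq> 0" "(Q has_field_derivative u) (at s)" "(P has_field_derivative v) (at s)"
  shows "((\<lambda>s. old_momentum \<epsilon> a (Q s) (P s)) has_field_derivative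
     (2 * (1 - \<epsilon> * Q s) * P s - \<epsilon> * a) * u - (1 - \<epsilon> * Q s)^2 / \<epsilon> * v) (at s)"
  unfolding old_momentum_def
  apply (rule derivative_eq_intros assms refl)+
  using assms(1) by (simp add: field_simps power2_eq_square)

section \<open>Regularity and the limit\<close>

text \<open>The denominator \<open>s\<close> does not contain the phase variables, so each partial derivative is a
  polynomial over the same \<open>s\<close>, and \<open>\<epsilon> \<rightarrow> 0\<close> can be taken by substitution.\<close>

lemma new_hamiltonian_gradient:
  fixes A1 A2 A3 A4 \<epsilon> T X Y Z W :: complex
  defines "p \<equiv> Y * (1 - \<epsilon> * X) - \<epsilon> * A1" and "q \<equiv> W * (1 - \<epsilon> * Z) - \<epsilon> * A3"
    and "s \<equiv> 1 + 2 * \<epsilon> * T" and "B \<equiv> 2 * A2 + 2 * A3 + A4"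
  assumes "s \<noteq> 0"
  shows "((\<lambda>Y. new_hamiltonian A1 A2 A3 A4 \<epsilon> T X Y Z W) has_field_derivative
      (4 * X * p * (1 - \<epsilon> * X) - 2 * \<epsilon> * B * X * (1 - \<epsilon> * X) - 2 * (A2 + A4) * (1 - \<epsilon> * X)^2
        - X^2 - 2 * T * X + 4 * (1 - \<epsilon> * X)^2 * Z * W) / s) (at Y)" (is ?Y)
    and "((\<lambda>X. new_hamiltonian A1 A2 A3 A4 \<epsilon> T X Y Z W) has_field_derivative
      (2 * p^2 - 4 * \<epsilon> * X * Y * p - 2 * \<epsilon> * B * (p - \<epsilon> * X * Y)
        + 2 * (A2 + A4) * \<epsilon> * (p + (1 - \<epsilon> * X) * Y) - 2 * X * Y - A1 - 2 * T * Y
        - 4 * \<epsilon> * (p + (1 - \<epsilon> * X) * Y) * Z * W) / s) (at X)" (is ?X)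
    and "((\<lambda>W. new_hamiltonian A1 A2 A3 A4 \<epsilon> T X Y Z W) has_field_derivative
      (4 * Z * q * (1 - \<epsilon> * Z) - 2 * \<epsilon> * A4 * Z * (1 - \<epsilon> * Z) - 2 * A4 * (1 - \<epsilon> * Z)^2
        - Z^2 - 2 * T * Z + 4 * (1 - \<epsilon> * X) * p * Z) / s) (at W)" (is ?W)
    and "((\<lambda>Z. new_hamiltonian A1 A2 A3 A4 \<epsilon> T X Y Z W) has_field_derivative
      (2 * q^2 - 4 * \<epsilon> * Z * W * q - 2 * \<epsilon> * A4 * (q - \<epsilon> * Z * W)
        + 2 * A4 * \<epsilon> * (q + (1 - \<epsilon> * Z) * W) - 2 * Z * W - A3 - 2 * T * W
        + 4 * (1 - \<epsilon> * X) * p * W) / s) (at Z)" (is ?Z)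
proof -
  \<comment> \<open>Each partial derivative sees only one of the brackets \<open>p\<close>, \<open>q\<close>. Treating it as a function \<open>f\<close> with
    known derivative keeps the polynomial identities small.\<close>
  show ?Y
  proof -
    define f where "f Y = Y * (1 - \<epsilon> * X) - \<epsilon> * A1" for Y
    have [derivative_intros]: "(f has_field_derivative 1 - \<epsilon> * X) (at Y)"
      unfolding f_def by (rule derivative_eq_intros refl | simp)+
    show ?thesis
      unfolding new_hamiltonian_def Let_def p_def q_def f_def[symmetric]
      unfolding q_def[symmetric] s_def[symmetric] B_def[symmetric]
      by (rule DERIV_cdivide, (rule derivative_eq_intros refl)+, simp add: algebra_simps power2_eq_square)
  qed
  show ?X
  proof -
    define f where "f X = Y * (1 - \<epsilon> * X) - \<epsilon> * A1" for X
    have [derivative_intros]: "(f has_field_derivative - (\<epsilon> * Y)) (at X)"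
      unfolding f_def by (rule derivative_eq_intros refl | simp)+
    show ?thesis
      unfolding new_hamiltonian_def Let_def p_def q_def f_def[symmetric]
      unfolding q_def[symmetric] s_def[symmetric] B_def[symmetric]
      by (rule DERIV_cdivide, (rule derivative_eq_intros refl)+, simp add: algebra_simps power2_eq_square)
  qed
  show ?W
  proof -
    define f where "f W = W * (1 - \<epsilon> * Z) - \<epsilon> * A3" for W
    have [derivative_intros]: "(f has_field_derivative 1 - \<epsilon> * Z) (at W)"
      unfolding f_def by (rule derivative_eq_intros refl | simp)+
    show ?thesis
      unfolding new_hamiltonian_def Let_def p_def q_def f_def[symmetric]
      unfolding p_def[symmetric] s_def[symmetric] B_def[symmetric]
      by (rule DERIV_cdivide, (rule derivative_eq_intros refl)+, simp add: algebra_simps power2_eq_square)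
  qed
  show ?Z
  proof -
    define f where "f Z = W * (1 - \<epsilon> * Z) - \<epsilon> * A3" for Z
    have [derivative_intros]: "(f has_field_derivative - (\<epsilon> * W)) (at Z)"
      unfolding f_def by (rule derivative_eq_intros refl | simp)+
    show ?thesis
      unfolding new_hamiltonian_def Let_def p_def q_def f_def[symmetric]
      unfolding p_def[symmetric] s_def[symmetric] B_def[symmetric]
      by (rule DERIV_cdivide, (rule derivative_eq_intros refl)+, simp add: algebra_simps power2_eq_square)
  qed
qed

lemma new_hamiltonian_field_tendsto:
  "((\<lambda>\<epsilon>. hamiltonian_field (new_hamiltonian A1 A2 A3 A4 \<epsilon>) T X Y Z W)
      \<longlongrightarrow> A4_field A1 A2 A3 A4 T X Y Z W) (at 0)"
proof -
  have "((\<lambda>\<epsilon>. 1 + 2 * \<epsilon> * T) \<longlongrightarrow> 1) (at 0)"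
    by (rule tendsto_eq_intros refl | simp)+
  then have ev: "\<forall>\<^sub>F \<epsilon> in at 0. 1 + 2 * \<epsilon> * T \<noteq> 0"
    by (rule tendsto_imp_eventually_ne) simp
  show ?thesis
    apply (rule Lim_transform_eventually[rotated])
     apply (rule eventually_mono[OF ev])
     apply (unfold hamiltonian_field_def)
     apply (subst new_hamiltonian_gradient(1)[THEN DERIV_imp_deriv], assumption)
     apply (subst new_hamiltonian_gradient(2)[THEN DERIV_imp_deriv], assumption)
     apply (subst new_hamiltonian_gradient(3)[THEN DERIV_imp_deriv], assumption)
     apply (subst new_hamiltonian_gradient(4)[THEN DERIV_imp_deriv], assumption)
     apply (rule refl)
    unfolding A4_field_def
    by (intro tendsto_Pair; (rule tendsto_eq_intros refl | simp add: algebra_simps power2_eq_square)+)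
qed

lemma hamiltonian_on_new_hamiltonian:
  "hamiltonian_on (new_domain \<epsilon>) (new_hamiltonian A1 A2 A3 A4 \<epsilon>)"
  unfolding hamiltonian_on_def
proof (clarify, intro conjI)
  fix T X Y Z W
  assume "(T, X, Y, Z, W) \<in> new_domain \<epsilon>"
  then have s: "1 + 2 * \<epsilon> * T \<noteq> 0" by (simp add: new_domain_def)
  show "(\<lambda>T. new_hamiltonian A1 A2 A3 A4 \<epsilon> T X Y Z W) field_differentiable (at T)"
    unfolding new_hamiltonian_def Let_def by (intro derivative_intros s)
  show "(\<lambda>X. new_hamiltonian A1 A2 A3 A4 \<epsilon> T X Y Z W) field_differentiable (at X)"
    unfolding field_differentiable_def by (rule exI, rule new_hamiltonian_gradient(2)[OF s])
  show "(\<lambda>Y. new_hamiltonian A1 A2 A3 A4 \<epsilon> T X Y Z W) field_differentiable (at Y)"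
    unfolding field_differentiable_def by (rule exI, rule new_hamiltonian_gradient(1)[OF s])
  show "(\<lambda>Z. new_hamiltonian A1 A2 A3 A4 \<epsilon> T X Y Z W) field_differentiable (at Z)"
    unfolding field_differentiable_def by (rule exI, rule new_hamiltonian_gradient(4)[OF s])
  show "(\<lambda>W. new_hamiltonian A1 A2 A3 A4 \<epsilon> T X Y Z W) field_differentiable (at W)"
    unfolding field_differentiable_def by (rule exI, rule new_hamiltonian_gradient(3)[OF s])
qed

section \<open>Equivalence of the two systems\<close>

text \<open>Invariance of Hamilton's equations under a canonical change of one pair at a time. By the
  chain rule \<open>X' = \<partial>K/\<partial>Y = \<epsilon>\<^sup>-\<^sup>1 f\<^sub>x \<partial>y/\<partial>Y\<close> and
  \<open>Y' = - \<partial>K/\<partial>X = \<epsilon>\<^sup>-\<^sup>1 (f\<^sub>y \<partial>x/\<partial>X - f\<^sub>x \<partial>y/\<partial>X)\<close>.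
  Since \<open>\<partial>x/\<partial>X \<cdot> \<partial>y/\<partial>Y = 1\<close>, these say that \<open>(x, y)\<close> moves with velocity \<open>(f\<^sub>x, f\<^sub>y) / \<epsilon>\<close>.\<close>

lemma new_hamiltonian_field_eq:
  assumes \<epsilon>: "\<epsilon> \<noteq> 0" and D: "(T, X, Y, Z, W) \<in> new_domain \<epsilon>"
    and F: "source_field A1 A2 A3 (- (inverse (\<epsilon>^2) / 2)) A4 (old_time \<epsilon> T)
      (old_position \<epsilon> X) (old_momentum \<epsilon> A1 X Y) (old_position \<epsilon> Z) (old_momentum \<epsilon> A3 Z W)
      = (fx, fy, fz, fw)"
    and K: "hamiltonian_field (new_hamiltonian A1 A2 A3 A4 \<epsilon>) T X Y Z W = (u, v, r, s)"
  shows "u = - ((1 - \<epsilon> * X)^2 / \<epsilon>^2) * fx"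
    and "v = - (fy / (1 - \<epsilon> * X)^2) - (2 * (1 - \<epsilon> * X) * Y - \<epsilon> * A1) / \<epsilon> * fx"
    and "r = - ((1 - \<epsilon> * Z)^2 / \<epsilon>^2) * fz"
    and "s = - (fw / (1 - \<epsilon> * Z)^2) - (2 * (1 - \<epsilon> * Z) * W - \<epsilon> * A3) / \<epsilon> * fz"
proof -
  let ?H = "\<lambda>X Y Z W. source_hamiltonian A1 A2 A3 (- (inverse (\<epsilon>^2) / 2)) A4 (old_time \<epsilon> T)
      (old_position \<epsilon> X) (old_momentum \<epsilon> A1 X Y) (old_position \<epsilon> Z) (old_momentum \<epsilon> A3 Z W) / \<epsilon>"
  let ?K = "new_hamiltonian A1 A2 A3 A4 \<epsilon> T"
  have nz: "1 + 2 * \<epsilon> * T \<noteq> 0" "1 - \<epsilon> * X \<noteq> 0" "1 - \<epsilon> * Z \<noteq> 0"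
    using D by (auto simp: new_domain_def)
  have t0: "old_time \<epsilon> T \<noteq> 0" using nz(1) \<epsilon> by (simp add: old_time_def)
  \<comment> \<open>\<open>K\<close> agrees with \<open>H / \<epsilon>\<close> only inside the domain, so the derivative of \<open>K\<close> along a curve is taken
    where the curve is still near \<open>(X, Y, Z, W)\<close>; the domain is open.\<close>
  have along: "((\<lambda>\<sigma>. ?K (X' \<sigma>) (Y' \<sigma>) (Z' \<sigma>) (W' \<sigma>)) has_field_derivative
      (fx * ((2 * (1 - \<epsilon> * X) * Y - \<epsilon> * A1) * dX - (1 - \<epsilon> * X)^2 / \<epsilon> * dY)
       - fy * (- (\<epsilon> / (1 - \<epsilon> * X)^2) * dX)
       + fz * ((2 * (1 - \<epsilon> * Z) * W - \<epsilon> * A3) * dZ - (1 - \<epsilon> * Z)^2 / \<epsilon> * dW)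
       - fw * (- (\<epsilon> / (1 - \<epsilon> * Z)^2) * dZ)) / \<epsilon>) (at \<sigma>)"
    if at: "X' \<sigma> = X" "Y' \<sigma> = Y" "Z' \<sigma> = Z" "W' \<sigma> = W"
      and d: "(X' has_field_derivative dX) (at \<sigma>)" "(Y' has_field_derivative dY) (at \<sigma>)"
        "(Z' has_field_derivative dZ) (at \<sigma>)" "(W' has_field_derivative dW) (at \<sigma>)"
    for X' Y' Z' W' :: "complex \<Rightarrow> complex" and \<sigma> dX dY dZ dW
  proof -
    have lim: "((\<lambda>\<sigma>. 1 - \<epsilon> * X' \<sigma>) \<longlongrightarrow> 1 - \<epsilon> * X) (at \<sigma>)"
        "((\<lambda>\<sigma>. 1 - \<epsilon> * Z' \<sigma>) \<longlongrightarrow> 1 - \<epsilon> * Z) (at \<sigma>)"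
      using DERIV_isCont[OF d(1)] DERIV_isCont[OF d(3)] at
      by (auto simp: isCont_def intro!: tendsto_intros)
    have "\<forall>\<^sub>F \<sigma> in at \<sigma>. (T, X' \<sigma>, Y' \<sigma>, Z' \<sigma>, W' \<sigma>) \<in> new_domain \<epsilon>"
      using tendsto_imp_eventually_ne[OF lim(1) nz(2)] tendsto_imp_eventually_ne[OF lim(2) nz(3)]
      by eventually_elim (use nz in \<open>simp add: new_domain_def\<close>)
    then have "\<forall>\<^sub>F \<sigma> in nhds \<sigma>. (T, X' \<sigma>, Y' \<sigma>, Z' \<sigma>, W' \<sigma>) \<in> new_domain \<epsilon>"
      using D at by (simp add: eventually_nhds_conv_at)
    then have ev: "\<forall>\<^sub>F \<sigma> in nhds \<sigma>. ?K (X' \<sigma>) (Y' \<sigma>) (Z' \<sigma>) (W' \<sigma>) = ?H (X' \<sigma>) (Y' \<sigma>) (Z' \<sigma>) (W' \<sigma>)"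
      by eventually_elim (rule new_hamiltonian_eq_pullback[OF \<epsilon>])
    have "((\<lambda>\<sigma>. ?H (X' \<sigma>) (Y' \<sigma>) (Z' \<sigma>) (W' \<sigma>)) has_field_derivative
      (fx * ((2 * (1 - \<epsilon> * X' \<sigma>) * Y' \<sigma> - \<epsilon> * A1) * dX - (1 - \<epsilon> * X' \<sigma>)^2 / \<epsilon> * dY)
       - fy * (- (\<epsilon> / (1 - \<epsilon> * X' \<sigma>)^2) * dX)
       + fz * ((2 * (1 - \<epsilon> * Z' \<sigma>) * W' \<sigma> - \<epsilon> * A3) * dZ - (1 - \<epsilon> * Z' \<sigma>)^2 / \<epsilon> * dW)
       - fw * (- (\<epsilon> / (1 - \<epsilon> * Z' \<sigma>)^2) * dZ)) / \<epsilon>) (at \<sigma>)"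
      using at nz F
      by (intro DERIV_cdivide source_hamiltonian_along_curve[OF t0] old_position_has_derivative
          old_momentum_has_derivative \<epsilon> d) simp_all
    then show ?thesis
      using DERIV_cong_ev[OF refl ev refl] at by simp
  qed
  have KY: "u = deriv (\<lambda>Y. ?K X Y Z W) Y" and KX: "v = - deriv (\<lambda>X. ?K X Y Z W) X"
    and KW: "r = deriv (\<lambda>W. ?K X Y Z W) W" and KZ: "s = - deriv (\<lambda>Z. ?K X Y Z W) Z"
    using K by (auto simp: hamiltonian_field_def)
  show "u = - ((1 - \<epsilon> * X)^2 / \<epsilon>^2) * fx"
    unfolding KY
    using DERIV_imp_deriv[OF along[of "\<lambda>_. X" Y "\<lambda>Y. Y" "\<lambda>_. Z" "\<lambda>_. W" 0 1 0 0]] \<epsilon>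
    by (simp add: power2_eq_square)
  show "r = - ((1 - \<epsilon> * Z)^2 / \<epsilon>^2) * fz"
    unfolding KW
    using DERIV_imp_deriv[OF along[of "\<lambda>_. X" W "\<lambda>_. Y" "\<lambda>_. Z" "\<lambda>W. W" 0 0 0 1]] \<epsilon>
    by (simp add: power2_eq_square)
  show "v = - (fy / (1 - \<epsilon> * X)^2) - (2 * (1 - \<epsilon> * X) * Y - \<epsilon> * A1) / \<epsilon> * fx"
    unfolding KX
    using DERIV_imp_deriv[OF along[of "\<lambda>X. X" X "\<lambda>_. Y" "\<lambda>_. Z" "\<lambda>_. W" 1 0 0 0]] \<epsilon>
    by (simp add: add_divide_distrib)
  show "s = - (fw / (1 - \<epsilon> * Z)^2) - (2 * (1 - \<epsilon> * Z) * W - \<epsilon> * A3) / \<epsilon> * fz"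
    unfolding KZ
    using DERIV_imp_deriv[OF along[of "\<lambda>_. X" Z "\<lambda>_. Y" "\<lambda>Z. Z" "\<lambda>_. W" 0 0 1 0]] \<epsilon>
    by (simp add: add_divide_distrib)
qed

lemma old_time_has_derivative:
  "\<epsilon> \<noteq> 0 \<Longrightarrow> (old_time \<epsilon> has_field_derivative 1 / \<epsilon>) (at T)"
  unfolding old_time_def
  by (rule derivative_eq_intros refl | simp add: field_simps power2_eq_square)+

lemma derivative_old_time_iff:
  assumes \<epsilon>: "\<epsilon> \<noteq> 0"
  shows "(x has_field_derivative f) (at (old_time \<epsilon> T))
     \<longleftrightarrow> ((\<lambda>T. x (old_time \<epsilon> T)) has_field_derivative f / \<epsilon>) (at T)"
proof
  show "((\<lambda>T. x (old_time \<epsilon> T)) has_field_derivative f / \<epsilon>) (at T)"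
    if "(x has_field_derivative f) (at (old_time \<epsilon> T))"
    using DERIV_chain2[OF that old_time_has_derivative[OF \<epsilon>]] by simp
next
  assume d: "((\<lambda>T. x (old_time \<epsilon> T)) has_field_derivative f / \<epsilon>) (at T)"
  \<comment> \<open>The inverse of \<open>old_time \<epsilon>\<close>.\<close>
  define \<tau> where "\<tau> = (\<lambda>t. \<epsilon> * t - 1 / (2 * \<epsilon>))"
  have \<tau>: "\<tau> (old_time \<epsilon> T) = T" for T
    using \<epsilon> by (simp add: \<tau>_def old_time_def field_simps power2_eq_square)
  have old: "old_time \<epsilon> (\<tau> t) = t" for t
    using \<epsilon> by (simp add: \<tau>_def old_time_def field_simps power2_eq_square)
  have "(\<tau> has_field_derivative \<epsilon>) (at t)" for t
    unfolding \<tau>_def by (rule derivative_eq_intros refl | simp)+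
  from DERIV_chain2[OF _ this, of "\<lambda>T. x (old_time \<epsilon> T)" "f / \<epsilon>" "old_time \<epsilon> T"] d
  show "(x has_field_derivative f) (at (old_time \<epsilon> T))"
    using \<epsilon> by (simp add: \<tau> old)
qed

text \<open>Velocities of an old pair and a new pair correspond. From new to old this is the chain rule.
  For the converse, differentiability of \<open>Q\<close> and \<open>P\<close> is not given and comes from the inverse change of
  variables \<open>Q = x / (\<epsilon> (x - 1))\<close>, \<open>P = \<epsilon> (1 - x) (a - y (1 - x))\<close>. The values of their derivatives
  then follow without differentiating these formulas: the Jacobian of the direct change is triangular
  and invertible, so two velocities with the same image coincide.\<close>

lemma derivatives_canonical_pair_iff:
  assumes \<epsilon>: "\<epsilon> \<noteq> 0" and U: "open U" "T \<in> U"
    and ne: "\<And>T. T \<in> U \<Longrightarrow> 1 - \<epsilon> * Q T \<noteq> 0"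
    and x: "\<And>T. T \<in> U \<Longrightarrow> x (old_time \<epsilon> T) = old_position \<epsilon> (Q T)"
    and y: "\<And>T. T \<in> U \<Longrightarrow> y (old_time \<epsilon> T) = old_momentum \<epsilon> a (Q T) (P T)"
    and u: "u = - ((1 - \<epsilon> * Q T)^2 / \<epsilon>^2) * f"
    and v: "v = - (g / (1 - \<epsilon> * Q T)^2) - (2 * (1 - \<epsilon> * Q T) * P T - \<epsilon> * a) / \<epsilon> * f"
  shows "(x has_field_derivative f) (at (old_time \<epsilon> T)) \<and> (y has_field_derivative g) (at (old_time \<epsilon> T))
     \<longleftrightarrow> (Q has_field_derivative u) (at T) \<and> (P has_field_derivative v) (at T)"
proof -
  define \<xi> \<eta> where \<xi>\<eta>: "\<xi> = (\<lambda>T. x (old_time \<epsilon> T))" "\<eta> = (\<lambda>T. y (old_time \<epsilon> T))"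
  note r0 = ne[OF U(2)]
  have fwd: "(\<xi> has_field_derivative - (\<epsilon> / (1 - \<epsilon> * Q T)^2) * u') (at T)"
      "(\<eta> has_field_derivative
         (2 * (1 - \<epsilon> * Q T) * P T - \<epsilon> * a) * u' - (1 - \<epsilon> * Q T)^2 / \<epsilon> * v') (at T)"
    if d: "(Q has_field_derivative u') (at T)" "(P has_field_derivative v') (at T)" for u' v'
    unfolding \<xi>\<eta>
    by (rule has_field_derivative_transform_within_open[OF old_position_has_derivative[OF r0 d(1)] U]
          has_field_derivative_transform_within_open[OF old_momentum_has_derivative[OF \<epsilon> d] U],
        simp add: x y)+
  have f: "- (\<epsilon> / (1 - \<epsilon> * Q T)^2) * u = f / \<epsilon>"
    using \<epsilon> r0 by (simp add: u power2_eq_square)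
  have g: "(2 * (1 - \<epsilon> * Q T) * P T - \<epsilon> * a) * u - (1 - \<epsilon> * Q T)^2 / \<epsilon> * v = g / \<epsilon>"
    using \<epsilon> r0 unfolding u v by (simp add: divide_simps) (simp add: algebra_simps power2_eq_square)
  have "(\<xi> has_field_derivative f / \<epsilon>) (at T) \<and> (\<eta> has_field_derivative g / \<epsilon>) (at T)
     \<longleftrightarrow> (Q has_field_derivative u) (at T) \<and> (P has_field_derivative v) (at T)"
  proof (intro iffI conjI; elim conjE)
    assume d: "(\<xi> has_field_derivative f / \<epsilon>) (at T)" "(\<eta> has_field_derivative g / \<epsilon>) (at T)"
    have \<xi>: "1 - \<xi> T = 1 / (1 - \<epsilon> * Q T)" if "T \<in> U" for T
      using ne[OF that] by (simp add: \<xi>\<eta> x[OF that] old_position_def field_simps)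
    have Q: "\<xi> T / (\<epsilon> * (\<xi> T - 1)) = Q T" if "T \<in> U" for T
    proof -
      have "\<xi> T - 1 = - (1 / (1 - \<epsilon> * Q T))" using \<xi>[OF that] by (simp add: algebra_simps)
      then show ?thesis
        using ne[OF that] \<epsilon> by (simp add: \<xi>\<eta> x[OF that] old_position_def)
    qed
    have P: "\<epsilon> * (1 - \<xi> T) * (a - \<eta> T * (1 - \<xi> T)) = P T" if "T \<in> U" for T
    proof -
      define \<rho> where "\<rho> = 1 - \<epsilon> * Q T"
      have "\<rho> \<noteq> 0" using ne[OF that] by (simp add: \<rho>_def)
      then show ?thesis
        unfolding \<xi>[OF that] using \<epsilon>
        by (simp add: \<xi>\<eta>(2) y[OF that] old_momentum_eq flip: \<rho>_def) (simp add: field_simps)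
    qed
    have "(\<lambda>T. \<xi> T / (\<epsilon> * (\<xi> T - 1))) field_differentiable (at T)"
      using d \<xi>[OF U(2)] r0 \<epsilon>
      by (intro derivative_intros) (auto simp: field_differentiable_def)
    then obtain u' where u': "(Q has_field_derivative u') (at T)"
      using has_field_derivative_transform_within_open[where g = Q, OF _ U Q]
      unfolding field_differentiable_def by blast
    have "(\<lambda>T. \<epsilon> * (1 - \<xi> T) * (a - \<eta> T * (1 - \<xi> T))) field_differentiable (at T)"
      using d by (intro derivative_intros) (auto simp: field_differentiable_def)
    then obtain v' where v': "(P has_field_derivative v') (at T)"
      using has_field_derivative_transform_within_open[where g = P, OF _ U P]
      unfolding field_differentiable_def by blast
    have "- (\<epsilon> / (1 - \<epsilon> * Q T)^2) * u' = - (\<epsilon> / (1 - \<epsilon> * Q T)^2) * u"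
      using DERIV_unique[OF fwd(1)[OF u' v'] d(1)] f by simp
    then have uu: "u' = u" using \<epsilon> r0 by simp
    then show "(Q has_field_derivative u) (at T)" using u' by simp
    have "(1 - \<epsilon> * Q T)^2 / \<epsilon> * v' = (1 - \<epsilon> * Q T)^2 / \<epsilon> * v"
      using DERIV_unique[OF fwd(2)[OF u' v'] d(2)] g unfolding uu by (simp add: algebra_simps)
    then have "v' = v" using \<epsilon> r0 by simp
    then show "(P has_field_derivative v) (at T)" using v' by simp
  next
    assume "(Q has_field_derivative u) (at T)" "(P has_field_derivative v) (at T)"
    from fwd[OF this] show "(\<xi> has_field_derivative f / \<epsilon>) (at T)" "(\<eta> has_field_derivative g / \<epsilon>) (at T)"
      unfolding f g by simp_all
  qed
  then show ?thesis
    unfolding \<xi>\<eta> derivative_old_time_iff[OF \<epsilon>, symmetric] .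
qed

lemma solves_variable_change_iff:
  assumes \<epsilon>: "\<epsilon> \<noteq> 0" and U: "open U" and V: "variable_change \<epsilon> A1 A3 U x y z w X Y Z W"
  shows "solves (source_field A1 A2 A3 (- (inverse (\<epsilon>^2) / 2)) A4) (old_time \<epsilon> ` U) x y z w
     \<longleftrightarrow> solves (hamiltonian_field (new_hamiltonian A1 A2 A3 A4 \<epsilon>)) U X Y Z W"
proof -
  let ?F = "source_field A1 A2 A3 (- (inverse (\<epsilon>^2) / 2)) A4"
  let ?K = "hamiltonian_field (new_hamiltonian A1 A2 A3 A4 \<epsilon>)"
  have "(case ?F (old_time \<epsilon> T) (x (old_time \<epsilon> T)) (y (old_time \<epsilon> T)) (z (old_time \<epsilon> T)) (w (old_time \<epsilon> T))
      of (fx, fy, fz, fw) \<Rightarrow>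
        (x has_field_derivative fx) (at (old_time \<epsilon> T)) \<and> (y has_field_derivative fy) (at (old_time \<epsilon> T)) \<and>
        (z has_field_derivative fz) (at (old_time \<epsilon> T)) \<and> (w has_field_derivative fw) (at (old_time \<epsilon> T)))
    \<longleftrightarrow> (case ?K T (X T) (Y T) (Z T) (W T) of (u, v, r, s) \<Rightarrow>
        (X has_field_derivative u) (at T) \<and> (Y has_field_derivative v) (at T) \<and>
        (Z has_field_derivative r) (at T) \<and> (W has_field_derivative s) (at T))"
    if T: "T \<in> U" for T
  proof -
    note V' = V[unfolded variable_change_def, rule_format]
    have D: "(T, X T, Y T, Z T, W T) \<in> new_domain \<epsilon>" using V'[OF T] by blast
    obtain fx fy fz fw where F: "?F (old_time \<epsilon> T) (x (old_time \<epsilon> T)) (y (old_time \<epsilon> T))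
        (z (old_time \<epsilon> T)) (w (old_time \<epsilon> T)) = (fx, fy, fz, fw)"
      by (metis prod_cases4)
    obtain u v r s where K: "?K T (X T) (Y T) (Z T) (W T) = (u, v, r, s)"
      by (metis prod_cases4)
    note E = new_hamiltonian_field_eq[OF \<epsilon> D _ K, of fx fy fz fw]
    have F': "?F (old_time \<epsilon> T) (old_position \<epsilon> (X T)) (old_momentum \<epsilon> A1 (X T) (Y T))
        (old_position \<epsilon> (Z T)) (old_momentum \<epsilon> A3 (Z T) (W T)) = (fx, fy, fz, fw)"
      using F V'[OF T] by simp
    have 1: "(x has_field_derivative fx) (at (old_time \<epsilon> T)) \<and> (y has_field_derivative fy) (at (old_time \<epsilon> T))
       \<longleftrightarrow> (X has_field_derivative u) (at T) \<and> (Y has_field_derivative v) (at T)"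
      using V' by (intro derivatives_canonical_pair_iff[where Q = X and P = Y and a = A1,
            OF \<epsilon> U T _ _ _ E(1)[OF F'] E(2)[OF F']])
        (auto simp: new_domain_def)
    have 2: "(z has_field_derivative fz) (at (old_time \<epsilon> T)) \<and> (w has_field_derivative fw) (at (old_time \<epsilon> T))
       \<longleftrightarrow> (Z has_field_derivative r) (at T) \<and> (W has_field_derivative s) (at T)"
      using V' by (intro derivatives_canonical_pair_iff[where Q = Z and P = W and a = A3,
            OF \<epsilon> U T _ _ _ E(3)[OF F'] E(4)[OF F']])
        (auto simp: new_domain_def)
    show ?thesis
      unfolding F K prod.case using 1 2 by blast
  qed
  then show ?thesis
    unfolding solves_def ball_simps by (rule ball_cong[OF refl])
qed

theorem theorem2p3:
  shows "\<exists>K :: complex \<Rightarrow> complex \<Rightarrow> complex \<Rightarrow> complex \<Rightarrow> complex \<Rightarrow> complex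
           \<Rightarrow> complex \<Rightarrow> complex \<Rightarrow> complex \<Rightarrow> complex \<Rightarrow> complex \<Rightarrow> complex.
    (\<forall>\<alpha>0 \<alpha>1 \<alpha>2 \<alpha>3 \<alpha>4 \<alpha>5 A0 A1 A2 A3 A4 \<epsilon>.
       \<epsilon> \<noteq> 0 \<and> \<alpha>0 + \<alpha>1 + 2 * \<alpha>2 + 2 * \<alpha>3 + \<alpha>4 + \<alpha>5 = 1 \<and>
       parameter_change \<alpha>0 \<alpha>1 \<alpha>2 \<alpha>3 \<alpha>4 \<alpha>5 A0 A1 A2 A3 A4 \<epsilon> \<longrightarrow>
         A0 + A1 + A2 + A3 + A4 = 1 \<and>
         hamiltonian_on (new_domain \<epsilon>) (K A0 A1 A2 A3 A4 \<epsilon>) \<and>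
         (\<forall>U x y z w X Y Z W.
            open U \<and> variable_change \<epsilon> A1 A3 U x y z w X Y Z W \<longrightarrow>
            (solves (source_field \<alpha>1 \<alpha>2 \<alpha>3 \<alpha>4 \<alpha>5) (old_time \<epsilon> ` U) x y z w \<longleftrightarrow>
             solves (hamiltonian_field (K A0 A1 A2 A3 A4 \<epsilon>)) U X Y Z W))) \<and>
    (\<forall>A0 A1 A2 A3 A4. A0 + A1 + A2 + A3 + A4 = 1 \<longrightarrow>
       (\<forall>T X Y Z W.
          ((\<lambda>\<epsilon>. hamiltonian_field (K A0 A1 A2 A3 A4 \<epsilon>) T X Y Z W)
             \<longlongrightarrow> A4_field A1 A2 A3 A4 T X Y Z W) (at 0)))"
proof (rule exI[where x = "\<lambda>A0. new_hamiltonian"], intro conjI allI impI; (elim conjE)?)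
  fix \<alpha>0 \<alpha>1 \<alpha>2 \<alpha>3 \<alpha>4 \<alpha>5 A0 A1 A2 A3 A4 \<epsilon> :: complex
  assume \<epsilon>: "\<epsilon> \<noteq> 0" and sum: "\<alpha>0 + \<alpha>1 + 2 * \<alpha>2 + 2 * \<alpha>3 + \<alpha>4 + \<alpha>5 = 1"
    and pc: "parameter_change \<alpha>0 \<alpha>1 \<alpha>2 \<alpha>3 \<alpha>4 \<alpha>5 A0 A1 A2 A3 A4 \<epsilon>"
  have "\<alpha>0 + \<alpha>1 + 2 * \<alpha>2 + 2 * \<alpha>3 + \<alpha>4 + \<alpha>5 = A0 + A1 + A2 + A3 + A4"
    using pc by (simp add: parameter_change_def)
  then show "A0 + A1 + A2 + A3 + A4 = 1"
    using sum by simp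
  show "hamiltonian_on (new_domain \<epsilon>) (new_hamiltonian A1 A2 A3 A4 \<epsilon>)"
    by (rule hamiltonian_on_new_hamiltonian)
  fix U x y z w X Y Z W
  assume "open U" "variable_change \<epsilon> A1 A3 U x y z w X Y Z W"
  then show "solves (source_field \<alpha>1 \<alpha>2 \<alpha>3 \<alpha>4 \<alpha>5) (old_time \<epsilon> ` U) x y z w \<longleftrightarrow>
      solves (hamiltonian_field (new_hamiltonian A1 A2 A3 A4 \<epsilon>)) U X Y Z W"
    using solves_variable_change_iff[OF \<epsilon>] pc by (simp add: parameter_change_def)
qed (rule new_hamiltonian_field_tendsto)

end
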